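(* Assume $v(r)=1-r$ for all $r\in[0,1]$ and let $\eta\in C^2([-1,0];\mathbb R)$ (extended by $0$ outside $[-1,0]$) be non-decreasing on $[-1,0]$ with $\|\eta\|_{L^1(\mathbb R)}=1$ and $\eta(-1)=0$. Fix $T>0$, $M_\Delta,\Delta x>0$ and $K\subset\subset\mathbb R$. Let $$\mathcal U_{\Delta,ad}=\Big\{U_o\in(L^1\cap BV)(\mathbb R;[0,1]):\ \exists(U_{o,j})_{j\in\mathbb Z}\text{ s.t. }U_o=\sum_{j\in\mathbb Z}U_{o,j}\chi_{C_j},\ \mathrm{TV}(U_o)\le M_\Delta,\ \mathrm{supp}(U_o)\subset K\Big\}$$ be equipped with the metric induced by the $L^1$ norm. Let $\mathcal J:L^1_{loc}(\mathbb R;\mathbb R)\to\mathbb R_{\ge0}$ and $\mathcal K:L^1_{loc}([0,T]\times\mathbb R;\mathbb R)\to\mathbb R_{\ge0}$ be continuous and $\mathcal I:L^1_{loc}(\mathbb R;\mathbb R)\to\mathbb R_{\ge0}$ be lower semi-continuous with respect to the $L^1_{loc}$ topologies. For $H>0$ define on $\mathcal U_{\Delta,ad}$ $$\mathcal G_{\Delta,H}(U_o)=\mathcal J(U_H(T,\cdot))+\mathcal K(U_H)+\mathcal I(U_o),\qquad \mathcal G_\Delta(U_o)=\mathcal J(U(T,\cdot))+\mathcal K(U)+\mathcal I(U_o),$$ where $U_H$ and $U$ are the approximate solutions produced from the initial datum $U_o$ by the nonlocal (with kernel $\eta_H$) and the local Eulerian–Lagrangian scheme, respectively. Given $H_n\to0^+$,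 let $U_o^n$ be a minimizer of $\mathcal G_{\Delta,H_n}$ in $\mathcal U_{\Delta,ad}$ for all $n\in\mathbb N$. Then, up to a subsequence, $U_o^n\to U_o$ in $L^1(\mathbb R;\mathbb R)$, where $U_o$ is a minimizer of $\mathcal G_\Delta$ in $\mathcal U_{\Delta,ad}$.
   Context: Grid: $x_j=j\Delta x$, $x_{j+1/2}=(j+\frac12)\Delta x$, $C_j=[x_{j-1/2},x_{j+1/2}]$, $j\in\mathbb Z$; $t^m=m\Delta t$, $m\in\mathbb N$, where the time step $\Delta t>0$ is fixed (independent of $H$ and of the datum) so that the CFL condition $|V_j^m|\le\frac18\frac{\Delta x}{\Delta t}$ holds for all velocities below (e.g. $\Delta t=\frac18\|v\|_{L^\infty([0,1])}^{-1}\Delta x$). $\chi_A$ is the indicator function. Local Eulerian–Lagrangian scheme: given $U_o=\sum_jU_{o,j}\chi_{C_j}$, set $U_j^0=U_{o,j}$ and $$U_j^{m+1}=\frac{U_{j-1}^m+2U_j^m+U_{j+1}^m}{4}+\frac{\Delta t}{4}\big[\mathcal F_j^m-\mathcal F_{j+1}^m\big],\qquad \mathcal F_j^m=\frac{1}{h_{j-1}^{m+1}}(U_j^m+U_{j-1}^m)(V_j^m+V_{j-1}^m),$$ with $V_j^m=v(U_j^m)$ and $h_j^{m+1}=\Delta x+\Delta t(V_{j+1}^m-V_j^m)$. The approximate solution is $U(t,x)=\sum_{j,m}U_j^m\chi_{C_j}(x)\chi_{[t^m,t^{m+1}]}(t)$, with the convention $U(t^m,\cdot)=\sum_jU_j^m\chi_{C_j}$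 (overlaps of the cells $C_j$ are negligible null sets). Nonlocal Eulerian–Lagrangian scheme with parameter $H>0$: the same formulas with $(U_H)_j^m$ in place of $U_j^m$, except that $(V_H)_j^m=v\big(((U_H)^m*_\Delta\eta_H)_j\big)$ (and correspondingly $(h_H)_j^{m+1}$, $(\mathcal F_H)_j^m$ use $V_H$). Here $\eta_H(x)=\frac1H\eta(\frac xH)$, $N_H=\lceil H/\Delta x\rceil$, and for $f=\sum_jf_j\chi_{C_j}$ $$(f*_\Delta\eta_H)_j=\frac{\sum_{k}f_{j-k}\,\eta_H(x_k)}{\sum_{k}\eta_H(x_k)},\qquad k\text{ ranging over }0,-1,\dots,-N_H+1.$$ *)

theory Defs
  imports "HOL-Analysis.Analysis"
begin

section \<open>Function spaces\<close>

text \<open>Elements of \<open>L\<^sup>1\<close>, \<open>BV\<close>, \<open>L\<^sup>1\<^sub>l\<^sub>o\<^sub>c\<close> are represented by plain functions, no quotient by equality almost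
  everywhere being taken; the notions from \<open>L1loc\<close> to \<open>ess_support\<close> depend only on the class.\<close>

definition L1loc :: "'a::euclidean_space set \<Rightarrow> ('a \<Rightarrow> real) set" where
  "L1loc D = {f. \<forall>C. compact C \<and> C \<subseteq> D \<longrightarrow> set_integrable lebesgue C f}"

text \<open>The topology of the seminorms \<open>f \<mapsto> \<integral>\<^sub>C \<bar>f\<bar>\<close>, with \<open>C\<close> a compact subset of \<open>D\<close>. Functions that
  agree almost everywhere on \<open>D\<close> have the same neighbourhoods, so a real-valued
  map that is continuous or lower semicontinuous for it factors through the quotient and ignores
  values outside \<open>D\<close>.\<close>

definition L1loc_topology :: "'a::euclidean_space set \<Rightarrow> ('a \<Rightarrow> real) topology" where
  "L1loc_topology D = topology_generated_by
     {{g \<in> L1loc D. (LINT x:C|lebesgue. \<bar>g x - f x\<bar>) < e} | f C e.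
        f \<in> L1loc D \<and> compact C \<and> C \<subseteq> D \<and> 0 < e}"

definition lower_semicontinuous_map :: "'b topology \<Rightarrow> ('b \<Rightarrow> real) \<Rightarrow> bool" where
  "lower_semicontinuous_map X f \<longleftrightarrow> (\<forall>a. openin X {x \<in> topspace X. a < f x})"

definition total_variation :: "(real \<Rightarrow> real) \<Rightarrow> ereal" where
  "total_variation f =
     (SUP \<phi>\<in>{\<phi>. \<phi> C1_differentiable_on UNIV \<and> compact (closure {x. \<phi> x \<noteq> 0}) \<and> (\<forall>x. \<bar>\<phi> x\<bar> \<le> 1)}.
        ereal (LINT x|lebesgue. f x * deriv \<phi> x))"

definition L1_BV :: "(real \<Rightarrow> real) set" where
  "L1_BV = {f. integrable lebesgue f \<and> total_variation f < \<infinity>}"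

text \<open>The complement of the largest open set on which \<open>f\<close> vanishes almost everywhere.\<close>

definition ess_support :: "(real \<Rightarrow> real) \<Rightarrow> real set" where
  "ess_support f = - \<Union>{A. open A \<and> (AE x in lebesgue. x \<in> A \<longrightarrow> f x = 0)}"

text \<open>One-sided derivatives at the end points of a closed interval.\<close>

definition C2_on :: "real set \<Rightarrow> (real \<Rightarrow> real) \<Rightarrow> bool" where
  "C2_on S f \<longleftrightarrow> (\<exists>f' f''.
     (\<forall>x\<in>S. (f has_real_derivative f' x) (at x within S)) \<and>
     (\<forall>x\<in>S. (f' has_real_derivative f'' x) (at x within S)) \<and>
     continuous_on S f'')"

section \<open>The grid\<close>

definition cell :: "real \<Rightarrow> int \<Rightarrow> real set" where
  "cell dx j = {(of_int j - 1/2) * dx .. (of_int j + 1/2) * dx}"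

definition cell_fun :: "real \<Rightarrow> (int \<Rightarrow> real) \<Rightarrow> real \<Rightarrow> real" where
  "cell_fun dx u x = (\<Sum>\<^sub>\<infinity>j\<in>UNIV. u j * indicator (cell dx j) x)"

text \<open>The sequence \<open>U\<^sub>o\<^sub>,\<^sub>j\<close> attached to a function that is constant on the cells; equality is meant
  in \<open>L\<^sup>1\<close>, adjacent cells overlapping in one point.\<close>

definition cell_values :: "real \<Rightarrow> (real \<Rightarrow> real) \<Rightarrow> int \<Rightarrow> real" where
  "cell_values dx U = (THE u. AE x in lebesgue. U x = cell_fun dx u x)"

section \<open>Eulerian--Lagrangian schemes\<close>

text \<open>In the next three definitions \<open>V\<close> is the sequence of the velocities \<open>V\<^sub>j\<^sup>m\<close> at the current time,
  and \<open>u\<close> the sequence of the \<open>U\<^sub>j\<^sup>m\<close>.\<close>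

definition EL_width :: "real \<Rightarrow> real \<Rightarrow> (int \<Rightarrow> real) \<Rightarrow> int \<Rightarrow> real" where
  "EL_width dt dx V j = dx + dt * (V (j + 1) - V j)"

definition EL_flux :: "real \<Rightarrow> real \<Rightarrow> (int \<Rightarrow> real) \<Rightarrow> (int \<Rightarrow> real) \<Rightarrow> int \<Rightarrow> real" where
  "EL_flux dt dx V u j =
     1 / EL_width dt dx V (j - 1) * (u j + u (j - 1)) * (V j + V (j - 1))"

definition EL_step :: "real \<Rightarrow> real \<Rightarrow> (int \<Rightarrow> real) \<Rightarrow> (int \<Rightarrow> real) \<Rightarrow> int \<Rightarrow> real" where
  "EL_step dt dx V u j =
     (u (j - 1) + 2 * u j + u (j + 1)) / 4
       + dt / 4 * (EL_flux dt dx V u j - EL_flux dt dx V u (j + 1))"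

text \<open>The local and the nonlocal scheme differ only in the map \<open>W\<close> sending \<open>(U\<^sub>j\<^sup>m)\<^sub>j\<close> to \<open>(V\<^sub>j\<^sup>m)\<^sub>j\<close>.\<close>

primrec EL_scheme ::
  "real \<Rightarrow> real \<Rightarrow> ((int \<Rightarrow> real) \<Rightarrow> int \<Rightarrow> real) \<Rightarrow> (int \<Rightarrow> real) \<Rightarrow> nat \<Rightarrow> int \<Rightarrow> real" where
  "EL_scheme dt dx W u\<^sub>0 0 = u\<^sub>0"
| "EL_scheme dt dx W u\<^sub>0 (Suc m) =
     EL_step dt dx (W (EL_scheme dt dx W u\<^sub>0 m)) (EL_scheme dt dx W u\<^sub>0 m)"

definition local_vel :: "(real \<Rightarrow> real) \<Rightarrow> (int \<Rightarrow> real) \<Rightarrow> int \<Rightarrow> real" where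
  "local_vel v u j = v (u j)"

definition rescaled_kernel :: "(real \<Rightarrow> real) \<Rightarrow> real \<Rightarrow> real \<Rightarrow> real" where
  "rescaled_kernel \<eta> H x = 1 / H * \<eta> (x / H)"

definition discrete_conv :: "real \<Rightarrow> (real \<Rightarrow> real) \<Rightarrow> real \<Rightarrow> (int \<Rightarrow> real) \<Rightarrow> int \<Rightarrow> real" where
  "discrete_conv dx \<eta> H f j =
     (\<Sum>k\<in>{- \<lceil>H / dx\<rceil> + 1..0}. f (j - k) * rescaled_kernel \<eta> H (of_int k * dx)) /
     (\<Sum>k\<in>{- \<lceil>H / dx\<rceil> + 1..0}. rescaled_kernel \<eta> H (of_int k * dx))"

definition nonlocal_vel ::
  "real \<Rightarrow> (real \<Rightarrow> real) \<Rightarrow> (real \<Rightarrow> real) \<Rightarrow> real \<Rightarrow> (int \<Rightarrow> real) \<Rightarrow> int \<Rightarrow> real" where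
  "nonlocal_vel dx v \<eta> H u j = v (discrete_conv dx \<eta> H u j)"

text \<open>The half-open time slabs implement the convention \<open>U(t\<^sup>m, x) = \<Sum>\<^sub>j U\<^sub>j\<^sup>m \<chi>\<^bsub>C\<^sub>j\<^esub>(x)\<close>.\<close>

definition EL_solution ::
  "real \<Rightarrow> real \<Rightarrow> ((int \<Rightarrow> real) \<Rightarrow> int \<Rightarrow> real) \<Rightarrow> (real \<Rightarrow> real) \<Rightarrow> real \<Rightarrow> real \<Rightarrow> real" where
  "EL_solution dt dx W Uo t x =
     (\<Sum>\<^sub>\<infinity>(j, m)\<in>UNIV. EL_scheme dt dx W (cell_values dx Uo) m j
        * indicator (cell dx j) x * indicator {real m * dt..<real (m + 1) * dt} t)"

section \<open>The optimization problem\<close>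

definition admissible :: "real \<Rightarrow> real \<Rightarrow> real set \<Rightarrow> (real \<Rightarrow> real) set" where
  "admissible dx M K =
     {Uo \<in> L1_BV. (AE x in lebesgue. Uo x \<in> {0..1}) \<and>
        (\<exists>u. AE x in lebesgue. Uo x = cell_fun dx u x) \<and>
        total_variation Uo \<le> ereal M \<and> ess_support Uo \<subseteq> K}"

definition cost ::
  "((real \<Rightarrow> real) \<Rightarrow> real) \<Rightarrow> ((real \<times> real \<Rightarrow> real) \<Rightarrow> real) \<Rightarrow> ((real \<Rightarrow> real) \<Rightarrow> real)
    \<Rightarrow> real \<Rightarrow> real \<Rightarrow> real \<Rightarrow> ((int \<Rightarrow> real) \<Rightarrow> int \<Rightarrow> real) \<Rightarrow> (real \<Rightarrow> real) \<Rightarrow> real" where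
  "cost \<J> \<K> \<I> T dt dx W Uo =
     \<J> (EL_solution dt dx W Uo T) + \<K> (\<lambda>(t, x). EL_solution dt dx W Uo t x) + \<I> Uo"

definition CFL ::
  "real \<Rightarrow> real \<Rightarrow> ((int \<Rightarrow> real) \<Rightarrow> int \<Rightarrow> real) \<Rightarrow> (real \<Rightarrow> real) \<Rightarrow> bool" where
  "CFL dt dx W Uo \<longleftrightarrow>
     (\<forall>m j. \<bar>W (EL_scheme dt dx W (cell_values dx Uo) m) j\<bar> \<le> 1/8 * (dx / dt))"

end

theory Submission
  imports Defs "HOL-Complex_Analysis.Great_Picard"
begin

text \<open>Since \<open>\<eta> 0 > 0\<close>, the discrete convolution is the identity as soon as \<open>H \<le> dx\<close>: the nonlocal and
  the local scheme then coincide, and \<open>Us n\<close> minimizes the local cost for all large \<open>n\<close>. The cell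
  values of admissible data lie in \<open>[0,1]\<close> and vanish outside a fixed finite set of cells, which gives
  a subsequence converging in \<open>L\<^sup>1\<close> to an admissible limit. The CFL condition for the zero datum
  forces \<open>8 dt \<le> dx\<close>; this yields the maximum principle for the local scheme, hence its continuity in
  the datum, and the local cost is lower semicontinuous along the subsequence.\<close>

section \<open>Convergence in the \<open>L1loc\<close> topology, and null sets\<close>

lemma topspace_L1loc_topology: "topspace (L1loc_topology D) = L1loc D"
proof -
  have "f \<in> topspace (L1loc_topology D)" if "f \<in> L1loc D" for f
  proof -
    \<comment> \<open>Over the empty compact set the seminorm is zero, so this subbasic set is all
      of \<open>L1loc D\<close>.\<close>
    have "f \<in> {g \<in> L1loc D. (LINT x:{}|lebesgue. \<bar>g x - f x\<bar>) < 1}"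
      using that by (simp add: set_lebesgue_integral_def)
    moreover have "compact {}" "{} \<subseteq> D" "(0::real) < 1" by auto
    ultimately show ?thesis
      unfolding L1loc_topology_def topology_generated_by_topspace
      using that by (intro UnionI[where X="{g \<in> L1loc D. (LINT x:{}|lebesgue. \<bar>g x - f x\<bar>) < 1}"]) blast+
  qed
  then show ?thesis
    unfolding L1loc_topology_def by auto
qed

text \<open>The topology comes from a subbasis of balls with arbitrary centres, so a tail of
  \<open>f\<close> is placed in an open set by induction on how that set is generated. Only the
  subbasic balls need an estimate.\<close>

lemma limitin_L1loc_topology:
  assumes f: "\<And>n. f n \<in> L1loc D" and g: "g \<in> L1loc D"
    and lim: "\<And>C. compact C \<Longrightarrow> C \<subseteq> D \<Longrightarrow> (\<lambda>n. LINT x:C|lebesgue. \<bar>f n x - g x\<bar>) \<longlonglongrightarrow> 0"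
  shows "limitin (L1loc_topology D) f g sequentially"
  unfolding limitin_def topspace_L1loc_topology
proof (intro conjI g allI impI)
  fix U assume U: "openin (L1loc_topology D) U \<and> g \<in> U"
  then have "generate_topology_on {{h \<in> L1loc D. (LINT x:C|lebesgue. \<bar>h x - k x\<bar>) < e} | k C e.
        k \<in> L1loc D \<and> compact C \<and> C \<subseteq> D \<and> 0 < e} U"
    by (simp add: L1loc_topology_def openin_topology_generated_by_iff)
  moreover have "g \<in> U" using U by simp
  ultimately show "\<forall>\<^sub>F n in sequentially. f n \<in> U"
  proof (induction rule: generate_topology_on.induct)
    case (Int a b)
    then show ?case by (auto intro: eventually_conj)
  next
    case (UN \<F>)
    then obtain V where V: "V \<in> \<F>" "g \<in> V" by auto
    from UN.IH[OF this] show ?case by eventually_elim (use V in blast)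
  next
    case (Basis S)
    then obtain k C e where S: "S = {h \<in> L1loc D. (LINT x:C|lebesgue. \<bar>h x - k x\<bar>) < e}"
      and k: "k \<in> L1loc D" and C: "compact C" "C \<subseteq> D" by blast
    have int: "set_integrable lebesgue C h" if "h \<in> L1loc D" for h
      using that C by (auto simp: L1loc_def)
    \<comment> \<open>The gap between this distance and the radius \<open>e\<close> absorbs the
      vanishing distance from \<open>f n\<close> to \<open>g\<close>; the triangle inequality then
      puts \<open>f n\<close> into the ball.\<close>
    have "(LINT x:C|lebesgue. \<bar>g x - k x\<bar>) < e" using Basis.prems S by simp
    moreover have "(\<lambda>n. (LINT x:C|lebesgue. \<bar>f n x - g x\<bar>) + (LINT x:C|lebesgue. \<bar>g x - k x\<bar>))
        \<longlonglongrightarrow> 0 + (LINT x:C|lebesgue. \<bar>g x - k x\<bar>)"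
      by (intro tendsto_add tendsto_const lim C)
    ultimately have "\<forall>\<^sub>F n in sequentially.
        (LINT x:C|lebesgue. \<bar>f n x - g x\<bar>) + (LINT x:C|lebesgue. \<bar>g x - k x\<bar>) < e"
      by (auto dest: order_tendstoD(2))
    then show ?case
    proof eventually_elim
      case (elim n)
      have "(LINT x:C|lebesgue. \<bar>f n x - k x\<bar>)
          \<le> (LINT x:C|lebesgue. \<bar>f n x - g x\<bar> + \<bar>g x - k x\<bar>)"
        by (intro set_integral_mono set_integral_add set_integrable_abs set_integral_diff int f g k) auto
      also have "\<dots> = (LINT x:C|lebesgue. \<bar>f n x - g x\<bar>) + (LINT x:C|lebesgue. \<bar>g x - k x\<bar>)"
        by (intro set_integral_add set_integrable_abs set_integral_diff int f g k)
      finally show ?case using elim f S by simp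
    qed
  qed auto
qed

lemma borel_measurable_lebesgue:
  fixes f :: "'a::euclidean_space \<Rightarrow> real"
  shows "f \<in> borel_measurable borel \<Longrightarrow> f \<in> borel_measurable lebesgue"
  by (intro measurable_completion) simp

lemma compact_lebesgue:
  fixes C :: "'a::euclidean_space set"
  assumes "compact C"
  shows "C \<in> sets lebesgue" "emeasure lebesgue C < \<infinity>"
  using assms lmeasurable_compact[of C] by (auto simp: fmeasurable_def)

lemma bounded_borel_in_L1loc:
  fixes f :: "'a::euclidean_space \<Rightarrow> real"
  assumes "f \<in> borel_measurable borel" "\<And>x. \<bar>f x\<bar> \<le> B"
  shows "f \<in> L1loc D"
  unfolding L1loc_def set_integrable_def
  using assms compact_lebesgue
  by (safe intro!: integrableI_bounded_set_indicator[where B=B] borel_measurable_lebesgue AE_I2) auto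

lemma integrable_imp_L1loc:
  assumes "integrable lebesgue f"
  shows "f \<in> L1loc D"
  unfolding L1loc_def set_integrable_def
  using assms compact_lebesgue by (safe intro!: integrable_mult_indicator)

text \<open>Dominated convergence on each compact set: the limit inherits the bound
  \<open>B\<close>, so the constant \<open>2 * B\<close> dominates the differences.\<close>

lemma limitin_L1loc_bounded_pointwise:
  fixes f :: "nat \<Rightarrow> 'a::euclidean_space \<Rightarrow> real"
  assumes f: "\<And>n. f n \<in> borel_measurable borel" "\<And>n x. \<bar>f n x\<bar> \<le> B"
    and g: "g \<in> borel_measurable borel" and lim: "\<And>x. (\<lambda>n. f n x) \<longlonglongrightarrow> g x"
  shows "limitin (L1loc_topology D) f g sequentially"
proof -
  have gB: "\<bar>g x\<bar> \<le> B" for x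
    using lim[of x] f(2) by (intro tendsto_upperbound[OF tendsto_rabs]) auto
  show ?thesis
  proof (rule limitin_L1loc_topology)
    fix C :: "'a set" assume C: "compact C"
    have "(\<lambda>n. integral\<^sup>L lebesgue (\<lambda>x. indicator C x *\<^sub>R \<bar>f n x - g x\<bar>)) \<longlonglongrightarrow> integral\<^sup>L lebesgue (\<lambda>x::'a. 0::real)"
    proof (rule integral_dominated_convergence[where w="\<lambda>x. indicator C x *\<^sub>R (2 * B)"])
      show "integrable lebesgue (\<lambda>x. indicator C x *\<^sub>R (2 * B))"
        using compact_lebesgue[OF C] by (intro integrableI_bounded_set_indicator[where B="\<bar>2 * B\<bar>"]) auto
      have "(\<lambda>n. \<bar>f n x - g x\<bar>) \<longlonglongrightarrow> \<bar>g x - g x\<bar>" for x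
        by (intro tendsto_intros lim)
      then show "AE x in lebesgue. (\<lambda>n. indicator C x *\<^sub>R \<bar>f n x - g x\<bar>) \<longlonglongrightarrow> 0"
        by (auto simp: indicator_def)
      have "\<bar>f n x - g x\<bar> \<le> 2 * B" for n x
        using f(2)[of n x] gB[of x] by linarith
      then show "AE x in lebesgue. norm (indicator C x *\<^sub>R \<bar>f n x - g x\<bar>) \<le> indicator C x *\<^sub>R (2 * B)" for n
        by (auto simp: indicator_def)
      show "(\<lambda>x. indicator C x *\<^sub>R \<bar>f n x - g x\<bar>) \<in> borel_measurable lebesgue" for n
        using compact_lebesgue[OF C] borel_measurable_lebesgue[OF f(1)] borel_measurable_lebesgue[OF g]
        by measurable
    qed auto
    then show "(\<lambda>n. LINT x:C|lebesgue. \<bar>f n x - g x\<bar>) \<longlonglongrightarrow> 0"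
      by (simp add: set_lebesgue_integral_def)
  qed (use f g gB in \<open>auto intro!: bounded_borel_in_L1loc\<close>)
qed

text \<open>A nonempty open set is not negligible. Applied to interiors of cells, this turns
  almost-everywhere statements into statements about single cell values.\<close>

lemma ex_in_open_if_AE:
  fixes A :: "'a::euclidean_space set"
  assumes "AE x in lebesgue. P x" "open A" "A \<noteq> {}"
  obtains x where "x \<in> A" "P x"
proof -
  have "\<exists>x\<in>A. P x"
  proof (rule ccontr)
    assume "\<not> ?thesis"
    with assms(1) have "AE x in lebesgue. x \<notin> A" by (auto elim: eventually_mono)
    then have "negligible A"
      using assms(2) by (simp add: AE_iff_null negligible_iff_null_sets)
    with assms show False by (metis open_not_negligible)
  qed
  then show thesis using that by blast
qed

section \<open>Piecewise constant functions on the grid\<close>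

lemma mem_cell_iff:
  assumes "dx > 0"
  shows "x \<in> cell dx j \<longleftrightarrow> j \<in> {\<lceil>x / dx - 1/2\<rceil>..\<lfloor>x / dx + 1/2\<rfloor>}"
  using assms by (auto simp: cell_def ceiling_le_iff le_floor_iff field_simps)

text \<open>A point lies in one cell, or in two at a common face, so the infinite sum has finite
  support.\<close>

lemma cell_fun_eq_sum:
  assumes "dx > 0"
  shows "cell_fun dx u x = sum u {\<lceil>x / dx - 1/2\<rceil>..\<lfloor>x / dx + 1/2\<rfloor>}"
proof -
  have "cell_fun dx u x = infsum u {\<lceil>x / dx - 1/2\<rceil>..\<lfloor>x / dx + 1/2\<rfloor>}"
    unfolding cell_fun_def
    by (rule infsum_cong_neutral) (auto simp: indicator_def mem_cell_iff[OF assms])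
  then show ?thesis by simp
qed

text \<open>The bound is 2 rather than 1 because a common face of two cells collects both
  values.\<close>

lemma cell_fun_bounds:
  assumes dx: "dx > 0" and u: "\<And>j. u j \<in> {0..1}"
  shows "cell_fun dx u x \<in> {0..2}"
proof -
  have "sum u {\<lceil>x / dx - 1/2\<rceil>..\<lfloor>x / dx + 1/2\<rfloor>} \<le> (\<Sum>j\<in>{\<lceil>x / dx - 1/2\<rceil>..\<lfloor>x / dx + 1/2\<rfloor>}. 1)"
    using u by (intro sum_mono) auto
  also have "\<dots> \<le> 2" by simp linarith
  finally show ?thesis
    using u by (auto simp: cell_fun_eq_sum[OF dx] intro!: sum_nonneg)
qed

lemma cell_fun_interior:
  assumes dx: "dx > 0" and x: "x \<in> interior (cell dx j)"
  shows "cell_fun dx u x = u j"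
proof -
  have "x / dx - 1/2 < j" "j < x / dx + 1/2"
    using x dx by (auto simp: cell_def field_simps)
  then have "\<lceil>x / dx - 1/2\<rceil> = j" "\<lfloor>x / dx + 1/2\<rfloor> = j"
    by linarith+
  then show ?thesis by (simp add: cell_fun_eq_sum[OF dx])
qed

lemma center_in_interior_cell: "dx > 0 \<Longrightarrow> of_int j * dx \<in> interior (cell dx j)"
  by (auto simp: cell_def algebra_simps)

text \<open>An equation almost everywhere holds at some interior point of each cell, where only the
  value of that cell is seen. This justifies the definite description in
  \<open>cell_values\<close>.\<close>

lemma AE_eq_cell_fun_unique:
  assumes dx: "dx > 0" and "AE x in lebesgue. U x = cell_fun dx u x"
    "AE x in lebesgue. U x = cell_fun dx w x"
  shows "u = w"
proof
  fix j
  have "AE x in lebesgue. cell_fun dx u x = cell_fun dx w x"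
    using assms(2,3) by eventually_elim simp
  then obtain x where "x \<in> interior (cell dx j)" "cell_fun dx u x = cell_fun dx w x"
    using center_in_interior_cell[OF dx] by (elim ex_in_open_if_AE[of _ "interior (cell dx j)"]) auto
  then show "u j = w j" by (simp add: cell_fun_interior[OF dx, of x j])
qed

lemma cell_values_eq:
  assumes "dx > 0" "AE x in lebesgue. U x = cell_fun dx u x"
  shows "cell_values dx U = u"
  unfolding cell_values_def using assms by (blast intro: AE_eq_cell_fun_unique)

lemma cell_fun_tendsto:
  assumes "dx > 0" "\<And>j. (\<lambda>n. u n j) \<longlonglongrightarrow> w j"
  shows "(\<lambda>n. cell_fun dx (u n) x) \<longlonglongrightarrow> cell_fun dx w x"
  using assms by (auto simp: cell_fun_eq_sum intro!: tendsto_sum)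

text \<open>The sum depends on \<open>x\<close> only through two measurable integer end points;
  countability of the integers allows composing over one end point at a time.\<close>

lemma cell_fun_measurable:
  assumes "dx > 0"
  shows "cell_fun dx u \<in> borel_measurable borel"
proof -
  have "(\<lambda>x. sum u {\<lceil>x / dx - 1/2\<rceil>..b}) \<in> borel_measurable borel" for b
    by (rule measurable_compose_countable[where f="\<lambda>a _. sum u {a..b}"]) simp_all
  then have "(\<lambda>x. sum u {\<lceil>x / dx - 1/2\<rceil>..\<lfloor>x / dx + 1/2\<rfloor>}) \<in> borel_measurable borel"
    by (rule measurable_compose_countable[where f="\<lambda>b x. sum u {\<lceil>x / dx - 1/2\<rceil>..b}"]) simp
  then show ?thesis by (simp add: cell_fun_eq_sum[OF assms, abs_def])
qed

section \<open>The approximate solution as a function of time and space\<close>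

lemma EL_solution_eq:
  assumes "dx > 0" "dt > 0"
  shows "EL_solution dt dx W U t x =
    (if t \<ge> 0 then cell_fun dx (EL_scheme dt dx W (cell_values dx U) (nat \<lfloor>t / dt\<rfloor>)) x else 0)"
proof (cases "t \<ge> 0")
  case True
  \<comment> \<open>The half-open slabs partition the nonnegative times, so exactly one time level
    contributes to the double sum.\<close>
  have "real m * dt \<le> t \<and> t < real (m + 1) * dt \<longleftrightarrow> m = nat \<lfloor>t / dt\<rfloor>" for m
  proof -
    have "real m * dt \<le> t \<and> t < real (m + 1) * dt \<longleftrightarrow> \<lfloor>t / dt\<rfloor> = int m"
      using assms(2) by (simp add: floor_eq_iff field_simps)
    also have "\<dots> \<longleftrightarrow> m = nat \<lfloor>t / dt\<rfloor>" using True assms(2) by (auto simp: nat_eq_iff)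
    finally show ?thesis .
  qed
  then have slab: "(indicator {real m * dt..<real (m + 1) * dt} t :: real)
      = (if m = nat \<lfloor>t / dt\<rfloor> then 1 else 0)" for m
    by (simp add: indicator_def del: of_nat_add)
  let ?u = "EL_scheme dt dx W (cell_values dx U)"
  let ?I = "{\<lceil>x / dx - 1/2\<rceil>..\<lfloor>x / dx + 1/2\<rfloor>} \<times> {nat \<lfloor>t / dt\<rfloor>}"
  have "EL_solution dt dx W U t x = infsum (\<lambda>(j, m). ?u m j) ?I"
    unfolding EL_solution_def slab
    by (rule infsum_cong_neutral)
      (auto simp: mem_cell_iff[OF assms(1)] indicator_def split: if_splits)
  also have "\<dots> = cell_fun dx (?u (nat \<lfloor>t / dt\<rfloor>)) x"
    by (simp add: cell_fun_eq_sum[OF assms(1)] flip: sum.cartesian_product)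
  finally show ?thesis using True by simp
next
  case False
  have "t < real m * dt" for m using False assms(2) by (smt (verit) mult_nonneg_nonneg of_nat_0_le_iff)
  then have "EL_solution dt dx W U t x = infsum (\<lambda>_. 0) (UNIV :: (int \<times> nat) set)"
    unfolding EL_solution_def by (intro infsum_cong) (auto simp: indicator_def not_le)
  then show ?thesis using False by simp
qed

lemma EL_solution_measurable:
  assumes "dx > 0" "dt > 0"
  shows "EL_solution dt dx W U t \<in> borel_measurable borel"
    and "(\<lambda>(t, x). EL_solution dt dx W U t x) \<in> borel_measurable borel"
proof -
  have [measurable]: "cell_fun dx u \<in> borel_measurable borel" for u
    by (rule cell_fun_measurable[OF assms(1)])
  show "EL_solution dt dx W U t \<in> borel_measurable borel"
    unfolding EL_solution_eq[OF assms, abs_def] by (cases "t \<ge> 0") auto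
  \<comment> \<open>The time level takes countably many values, which reduces joint measurability to
    a fixed \<open>m\<close>.\<close>
  have "(\<lambda>p. (\<lambda>m (p::real\<times>real). if fst p \<ge> 0 then cell_fun dx (EL_scheme dt dx W (cell_values dx U) m) (snd p) else 0)
      (nat \<lfloor>fst p / dt\<rfloor>) p) \<in> borel_measurable (borel \<Otimes>\<^sub>M borel)"
    by (rule measurable_compose_countable) measurable
  then show "(\<lambda>(t, x). EL_solution dt dx W U t x) \<in> borel_measurable borel"
    by (simp add: EL_solution_eq[OF assms] borel_prod case_prod_beta)
qed

section \<open>Maximum principle and continuity of the local scheme\<close>

lemma scaled_flux_bounds:
  fixes a b c L :: real
  assumes L: "0 < L" "L \<le> 1/8" and u: "a \<in> {0..1}" "b \<in> {0..1}"
  shows "0 \<le> L * ((b + a) * (2 - a - b) / (1 + L * (a - b)))"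
    "L * ((b + a) * (2 - a - b) / (1 + L * (a - b))) \<le> a + b"
    "L * ((b + a) * (2 - a - b) / (1 + L * (a - b))) \<le> 2 - a - b"
proof -
  have "L * \<bar>a - b\<bar> \<le> L * 1" using L u by (intro mult_left_mono) auto
  then have "\<bar>L * (a - b)\<bar> \<le> 1/8" using L by (simp only: abs_mult)
  then have D: "1 + L * (a - b) \<ge> 7/8" by linarith
  then have D_pos: "0 < 1 + L * (a - b)" by linarith
  show "0 \<le> L * ((b + a) * (2 - a - b) / (1 + L * (a - b)))"
    using L u D by (intro mult_nonneg_nonneg divide_nonneg_pos) auto
  \<comment> \<open>Used with \<open>p\<close> and \<open>q\<close> the two factors
    \<open>a + b\<close> and \<open>2 - a - b\<close>, in either order: \<open>L * q\<close> is at
    most 1/4, while the denominator is at least 7/8.\<close>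
  have *: "L * (p * q) \<le> p * (1 + L * (a - b))" if "p \<ge> 0" "q \<le> 2" for p q
  proof -
    have "L * q \<le> L * 2" using L that by (intro mult_left_mono) auto
    then have "p * (L * q) \<le> p * (1 + L * (a - b))"
      using that D L by (intro mult_left_mono) linarith+
    then show ?thesis by (simp add: ac_simps)
  qed
  show "L * ((b + a) * (2 - a - b) / (1 + L * (a - b))) \<le> a + b"
    unfolding times_divide_eq_right pos_divide_le_eq[OF D_pos]
    using *[of "a + b" "2 - a - b"] u by (simp add: add.commute)
  show "L * ((b + a) * (2 - a - b) / (1 + L * (a - b))) \<le> 2 - a - b"
    unfolding times_divide_eq_right pos_divide_le_eq[OF D_pos]
    using *[of "2 - a - b" "a + b"] u by (simp add: ac_simps)
qed

text \<open>A factor \<open>dx\<close> comes out of the width, so the scaled flux sees the mesh only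
  through \<open>dt / dx\<close>, which plays the role of \<open>L\<close> in
  \<open>scaled_flux_bounds\<close>.\<close>

lemma EL_flux_local_eq:
  assumes v: "\<forall>r\<in>{0..1}. v r = 1 - r" and dx: "dx > 0"
    and u: "\<And>j. u j \<in> {0..1}"
  shows "dt * EL_flux dt dx (local_vel v u) u j =
    dt / dx * ((u j + u (j - 1)) * (2 - u (j - 1) - u j) / (1 + dt / dx * (u (j - 1) - u j)))"
proof -
  have V: "local_vel v u i = 1 - u i" for i
    using v u by (simp add: local_vel_def)
  define D where "D = 1 + dt / dx * (u (j - 1) - u j)"
  have "EL_width dt dx (local_vel v u) (j - 1) = dx * D"
    using dx by (simp add: EL_width_def V D_def field_simps)
  moreover have "1 - u j + (1 - u (j - 1)) = 2 - u (j - 1) - u j" by simp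
  ultimately show ?thesis
    by (simp only: EL_flux_def V flip: D_def) simp
qed

lemma EL_step_local_bounds:
  assumes v: "\<forall>r\<in>{0..1}. v r = 1 - r" and dt: "0 < dt" "8 * dt \<le> dx"
    and u: "\<And>j. u j \<in> {0..1}"
  shows "EL_step dt dx (local_vel v u) u j \<in> {0..1}"
proof -
  let ?F = "\<lambda>j. dt * EL_flux dt dx (local_vel v u) u j"
  have L: "0 < dt / dx" "dt / dx \<le> 1/8" and dx: "dx > 0" using dt by (simp_all add: field_simps)
  have F: "0 \<le> ?F i" "?F i \<le> u (i - 1) + u i" "?F i \<le> 2 - u (i - 1) - u i" for i
  proof -
    have "?F i = dt / dx * ((u i + u (i - 1)) * (2 - u (i - 1) - u i) / (1 + dt / dx * (u (i - 1) - u i)))"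
      by (rule EL_flux_local_eq) (use v dx u in auto)
    then show "0 \<le> ?F i" "?F i \<le> u (i - 1) + u i" "?F i \<le> 2 - u (i - 1) - u i"
      using scaled_flux_bounds[OF L, of "u (i - 1)" "u i"] u by simp_all
  qed
  \<comment> \<open>Here \<open>P\<close> and \<open>Q\<close> are the scaled fluxes through the
    left and right face. The bound on \<open>Q\<close> gives \<open>s\<close> at least
    \<open>(a + b) / 4\<close>, the bound on \<open>P\<close> gives \<open>s\<close> at most
    \<open>(b + c + 2) / 4\<close>.\<close>
  have "s \<in> {0..1}"
    if "s = (a + 2 * b + c) / 4 + (P - Q) / 4" "0 \<le> P" "P \<le> 2 - a - b" "0 \<le> Q" "Q \<le> b + c"
      "a \<in> {0..1}" "b \<in> {0..1}" "c \<in> {0..1}" for s a b c P Q :: real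
    using that by (auto simp: field_simps)
  moreover have "EL_step dt dx (local_vel v u) u j
      = (u (j - 1) + 2 * u j + u (j + 1)) / 4 + (?F j - ?F (j + 1)) / 4"
    by (simp add: EL_step_def field_simps)
  moreover have "?F (j + 1) \<le> u j + u (j + 1)" using F(2)[of "j + 1"] by simp
  ultimately show ?thesis using F(1,3) u by blast
qed

lemma EL_scheme_local_bounds:
  assumes v: "\<forall>r\<in>{0..1}. v r = 1 - r" and dt: "0 < dt" "8 * dt \<le> dx"
    and u: "\<And>j. u j \<in> {0..1}"
  shows "EL_scheme dt dx (local_vel v) u m j \<in> {0..1}"
proof (induction m arbitrary: j)
  case (Suc m)
  show ?case
    unfolding EL_scheme.simps by (rule EL_step_local_bounds[OF v dt Suc.IH])
qed (use u in simp)

text \<open>One step reads only the values at \<open>j\<close> and its two neighbours, so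
  convergence cell by cell suffices; the one point to check is that no width in the limit is
  zero.\<close>

lemma EL_step_local_tendsto:
  assumes v: "\<forall>r\<in>{0..1}. v r = 1 - r" and dt: "0 < dt" "8 * dt \<le> dx"
    and u: "\<And>n j. u n j \<in> {0..1}" and w: "\<And>j. w j \<in> {0..1}"
    and lim: "\<And>j. (\<lambda>n. u n j) \<longlonglongrightarrow> w j"
  shows "(\<lambda>n. EL_step dt dx (local_vel v (u n)) (u n) j) \<longlonglongrightarrow> EL_step dt dx (local_vel v w) w j"
proof -
  have V: "(\<lambda>n. local_vel v (u n) i) \<longlonglongrightarrow> local_vel v w i" for i
    using v u w by (simp add: local_vel_def) (intro tendsto_intros lim)
  \<comment> \<open>Values in [0,1] shrink the width by at most \<open>dt\<close>, which is at most
    an eighth of \<open>dx\<close>.\<close>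
  have "EL_width dt dx (local_vel v w) i \<noteq> 0" for i
  proof -
    have "dt * (w i - w (i + 1)) \<ge> dt * (-1)"
      using w[of i] w[of "i + 1"] dt by (intro mult_left_mono) auto
    then show ?thesis using dt v w by (simp add: EL_width_def local_vel_def)
  qed
  then have "(\<lambda>n. EL_flux dt dx (local_vel v (u n)) (u n) i) \<longlonglongrightarrow> EL_flux dt dx (local_vel v w) w i" for i
    unfolding EL_flux_def EL_width_def by (intro tendsto_intros lim V)
  then show ?thesis
    unfolding EL_step_def by (intro tendsto_intros lim) auto
qed

lemma EL_scheme_local_tendsto:
  assumes v: "\<forall>r\<in>{0..1}. v r = 1 - r" and dt: "0 < dt" "8 * dt \<le> dx"
    and u: "\<And>n j. u n j \<in> {0..1}" and w: "\<And>j. w j \<in> {0..1}"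
    and lim: "\<And>j. (\<lambda>n. u n j) \<longlonglongrightarrow> w j"
  shows "(\<lambda>n. EL_scheme dt dx (local_vel v) (u n) m j) \<longlonglongrightarrow> EL_scheme dt dx (local_vel v) w m j"
proof (induction m arbitrary: j)
  case (Suc m)
  show ?case
    unfolding EL_scheme.simps
    by (intro EL_step_local_tendsto[OF v dt _ _ Suc.IH] EL_scheme_local_bounds[OF v dt] u w)
qed (use lim in simp)

text \<open>The maximum principle bounds the solutions uniformly, and convergence of the cell values
  makes them converge at every point, so dominated convergence gives both limits.\<close>

lemma limitin_EL_solution:
  assumes v: "\<forall>r\<in>{0..1}. v r = 1 - r" and dt: "0 < dt" "8 * dt \<le> dx"
    and u: "\<And>n j. cell_values dx (U n) j \<in> {0..1}" and w: "\<And>j. cell_values dx W j \<in> {0..1}"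
    and lim: "\<And>j. (\<lambda>n. cell_values dx (U n) j) \<longlonglongrightarrow> cell_values dx W j"
  shows "limitin (L1loc_topology D) (\<lambda>n. EL_solution dt dx (local_vel v) (U n) t)
      (EL_solution dt dx (local_vel v) W t) sequentially"
    and "limitin (L1loc_topology E) (\<lambda>n (t, x). EL_solution dt dx (local_vel v) (U n) t x)
      (\<lambda>(t, x). EL_solution dt dx (local_vel v) W t x) sequentially"
proof -
  have dx: "dx > 0" using dt by simp
  have bound: "\<bar>EL_solution dt dx (local_vel v) (U n) t x\<bar> \<le> 2" for n t x
  proof -
    have "cell_fun dx (EL_scheme dt dx (local_vel v) (cell_values dx (U n)) m) x \<in> {0..2}" for m
      by (intro cell_fun_bounds EL_scheme_local_bounds v dt dx u)
    then show ?thesis by (simp add: EL_solution_eq[OF dx dt(1)])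
  qed
  have conv: "(\<lambda>n. EL_solution dt dx (local_vel v) (U n) t x)
      \<longlonglongrightarrow> EL_solution dt dx (local_vel v) W t x" for t x
    unfolding EL_solution_eq[OF dx dt(1)]
    by (cases "t \<ge> 0") (auto intro!: cell_fun_tendsto[OF dx] EL_scheme_local_tendsto[OF v dt u w lim])
  show "limitin (L1loc_topology D) (\<lambda>n. EL_solution dt dx (local_vel v) (U n) t)
      (EL_solution dt dx (local_vel v) W t) sequentially"
    by (intro limitin_L1loc_bounded_pointwise[where B=2] EL_solution_measurable dx dt bound conv)
  show "limitin (L1loc_topology E) (\<lambda>n (t, x). EL_solution dt dx (local_vel v) (U n) t x)
      (\<lambda>(t, x). EL_solution dt dx (local_vel v) W t x) sequentially"
    by (intro limitin_L1loc_bounded_pointwise[where B=2] EL_solution_measurable dx dt)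
      (auto intro: bound conv)
qed

section \<open>Collapse of the nonlocal velocity to the local one\<close>

lemma kernel_pos_at_zero:
  fixes \<eta> :: "real \<Rightarrow> real"
  assumes "\<And>x. x \<notin> {-1..0} \<Longrightarrow> \<eta> x = 0" "mono_on {-1..0} \<eta>" "\<eta> (-1) = 0"
    and norm: "(LINT x|lebesgue. \<bar>\<eta> x\<bar>) = 1"
  shows "\<eta> 0 > 0"
proof (rule ccontr)
  assume "\<not> \<eta> 0 > 0"
  \<comment> \<open>Monotonicity would squeeze the kernel between \<open>\<eta> (-1) = 0\<close> and
    a nonpositive \<open>\<eta> 0\<close>, against its unit norm. Positivity is what allows the
    single remaining weight to be cancelled in \<open>discrete_conv\<close>.\<close>
  have "\<eta> x = 0" for x
  proof (cases "x \<in> {-1..0}")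
    case True
    then have "\<eta> (-1) \<le> \<eta> x" "\<eta> x \<le> \<eta> 0"
      using assms(2) by (auto intro!: mono_onD[OF assms(2)])
    with \<open>\<not> \<eta> 0 > 0\<close> assms(3) show ?thesis by simp
  qed (use assms(1) in simp)
  then show False using norm by simp
qed

text \<open>For \<open>h \<le> dx\<close> the discrete kernel has the single node \<open>k = 0\<close>.\<close>

lemma nonlocal_vel_eq_local_vel:
  assumes "0 < h" "h \<le> dx" "\<eta> 0 > 0"
  shows "nonlocal_vel dx v \<eta> h = local_vel v"
proof -
  have "\<lceil>h / dx\<rceil> = 1" using assms by (simp add: ceiling_eq_iff)
  then have "{- \<lceil>h / dx\<rceil> + 1..0} = {0}" by simp
  then show ?thesis
    using assms unfolding nonlocal_vel_def local_vel_def discrete_conv_def rescaled_kernel_def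
    by (simp add: fun_eq_iff)
qed

section \<open>Admissible data and their limits\<close>

lemma total_variation_le_iff:
  "total_variation f \<le> ereal M \<longleftrightarrow>
    (\<forall>\<phi>. \<phi> C1_differentiable_on UNIV \<longrightarrow> compact (closure {x. \<phi> x \<noteq> 0}) \<longrightarrow> (\<forall>x. \<bar>\<phi> x\<bar> \<le> 1) \<longrightarrow>
      (LINT x|lebesgue. f x * deriv \<phi> x) \<le> M)"
  unfolding total_variation_def by (auto simp: SUP_le_iff)

text \<open>The last claim turns the support condition into one on indices: if \<open>K\<close> is
  bounded, only finitely many cells can carry a nonzero value.\<close>

lemma admissible_cell_values:
  assumes dx: "dx > 0" and U: "U \<in> admissible dx M K"
  shows "AE x in lebesgue. U x = cell_fun dx (cell_values dx U) x"
    and "cell_values dx U j \<in> {0..1}"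
    and "cell_values dx U j \<noteq> 0 \<Longrightarrow> of_int j * dx \<in> K"
proof -
  let ?u = "cell_values dx U"
  obtain u where u: "AE x in lebesgue. U x = cell_fun dx u x"
    using U by (auto simp: admissible_def)
  then show eq: "AE x in lebesgue. U x = cell_fun dx ?u x"
    using cell_values_eq[OF dx u] by simp
  have "AE x in lebesgue. U x \<in> {0..1}" using U by (simp add: admissible_def)
  then have "AE x in lebesgue. cell_fun dx ?u x \<in> {0..1}"
    using eq by eventually_elim simp
  then obtain x where "x \<in> interior (cell dx j)" "cell_fun dx ?u x \<in> {0..1}"
    using center_in_interior_cell[OF dx] by (elim ex_in_open_if_AE[of _ "interior (cell dx j)"]) auto
  then show "?u j \<in> {0..1}" by (simp only: cell_fun_interior[OF dx, of x j])
  assume "?u j \<noteq> 0"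
  \<comment> \<open>Any open set around the centre meets the interior of the cell in a nonempty open
    set, where the cell function has the constant nonzero value \<open>?u j\<close>.\<close>
  have "of_int j * dx \<in> ess_support U"
    unfolding ess_support_def
  proof clarify
    fix A assume A: "open A" "of_int j * dx \<in> A" "AE x in lebesgue. x \<in> A \<longrightarrow> U x = 0"
    then have "AE x in lebesgue. x \<in> A \<longrightarrow> cell_fun dx ?u x = 0"
      using eq by (auto elim: eventually_elim2)
    moreover have "open (A \<inter> interior (cell dx j))" "A \<inter> interior (cell dx j) \<noteq> {}"
      using A center_in_interior_cell[OF dx] by auto
    ultimately obtain x where "x \<in> A \<inter> interior (cell dx j)" "x \<in> A \<longrightarrow> cell_fun dx ?u x = 0"
      by (rule ex_in_open_if_AE)
    then show False using \<open>?u j \<noteq> 0\<close> by (simp add: cell_fun_interior[OF dx, of x j])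
  qed
  then show "of_int j * dx \<in> K" using U by (auto simp: admissible_def)
qed

lemma cell_fun_nonzeroD:
  assumes "dx > 0" "cell_fun dx u x \<noteq> 0"
  obtains j where "u j \<noteq> 0" "x \<in> cell dx j"
proof -
  from assms obtain j where "j \<in> {\<lceil>x / dx - 1/2\<rceil>..\<lfloor>x / dx + 1/2\<rfloor>}" "u j \<noteq> 0"
    by (auto simp: cell_fun_eq_sum elim: sum.not_neutral_contains_not_neutral)
  then show thesis by (simp add: that mem_cell_iff[OF assms(1)])
qed

lemma zero_admissible:
  assumes "M \<ge> 0"
  shows "(\<lambda>_. 0) \<in> admissible dx M K"
proof -
  have tv: "total_variation (\<lambda>_. 0) \<le> ereal M"
    using assms by (simp add: total_variation_le_iff)
  then have "total_variation (\<lambda>_. 0) < \<infinity>" by (rule order.strict_trans1) simp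
  moreover have "ess_support (\<lambda>_. 0) = {}" by (auto simp: ess_support_def)
  moreover have "cell_fun dx (\<lambda>_. 0) x = 0" for x by (simp add: cell_fun_def)
  ultimately show ?thesis
    using tv by (auto simp: admissible_def L1_BV_def intro!: exI[of _ "\<lambda>_. 0"])
qed

text \<open>The zero datum is admissible and moves at speed \<open>v 0 = 1\<close> at the initial
  time, so the CFL condition for it is already a bound on \<open>dt\<close>.\<close>

lemma CFL_imp_time_step_bound:
  assumes v: "v 0 = 1" and "M \<ge> 0" "dx > 0" "dt > 0"
    and CFL: "\<And>Uo. Uo \<in> admissible dx M K \<Longrightarrow> CFL dt dx (local_vel v) Uo"
  shows "8 * dt \<le> dx"
proof -
  have "cell_values dx (\<lambda>_. 0) = (\<lambda>_. 0)"
    using assms by (intro cell_values_eq) (auto simp: cell_fun_def)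
  moreover have "CFL dt dx (local_vel v) (\<lambda>_. 0)"
    by (intro CFL zero_admissible assms)
  then have "\<bar>local_vel v (EL_scheme dt dx (local_vel v) (cell_values dx (\<lambda>_. 0)) 0) 0\<bar> \<le> 1/8 * (dx / dt)"
    unfolding CFL_def by blast
  ultimately have "1 \<le> 1/8 * (dx / dt)" by (simp add: local_vel_def v)
  then show ?thesis using assms by (simp add: field_simps)
qed

text \<open>All cell functions live on one bounded interval and are uniformly bounded there, so
  convergence of the cell values becomes \<open>L1\<close> convergence by domination, and each
  constraint passes to the limit.\<close>

lemma admissible_limit:
  assumes dx: "dx > 0" and K: "bounded K"
    and U: "\<And>n. U n \<in> admissible dx M K"
    and lim: "\<And>j. (\<lambda>n. cell_values dx (U n) j) \<longlonglongrightarrow> w j"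
  shows "cell_fun dx w \<in> admissible dx M K"
    and "(\<lambda>n. LINT x|lebesgue. \<bar>U n x - cell_fun dx w x\<bar>) \<longlonglongrightarrow> 0"
proof -
  let ?u = "\<lambda>n. cell_values dx (U n)"
  note [measurable] = borel_measurable_lebesgue[OF cell_fun_measurable[OF dx]]
  note eq = admissible_cell_values(1)[OF dx U]
  have u01: "?u n j \<in> {0..1}" for n j by (rule admissible_cell_values(2)[OF dx U])
  have w01: "w j \<in> {0..1}" for j
    by (rule Lim_in_closed_set[OF _ _ _ lim]) (use u01 in auto)
  obtain B where B: "\<And>x. x \<in> K \<Longrightarrow> \<bar>x\<bar> \<le> B"
    using K by (auto simp: bounded_iff)
  have u_supp: "\<forall>j. ?u n j \<noteq> 0 \<longrightarrow> \<bar>of_int j * dx\<bar> \<le> B" for n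
    using B admissible_cell_values(3)[OF dx U] by blast
  have w_supp: "\<forall>j. w j \<noteq> 0 \<longrightarrow> \<bar>of_int j * dx\<bar> \<le> B"
  proof (intro allI impI, rule ccontr)
    fix j assume "w j \<noteq> 0" "\<not> \<bar>of_int j * dx\<bar> \<le> B"
    then have "?u n j = 0" for n using u_supp by blast
    then have "w j = 0" using LIMSEQ_unique[OF lim[of j]] by simp
    then show False using \<open>w j \<noteq> 0\<close> by simp
  qed
  \<comment> \<open>A cell with nonzero value has its centre within \<open>B\<close> of the origin
    and half-width \<open>dx / 2\<close>, so widening by \<open>dx\<close> covers it.\<close>
  let ?S = "{- (B + dx)..B + dx}"
  have supp: "cell_fun dx f x = 0" if "\<forall>j. f j \<noteq> 0 \<longrightarrow> \<bar>of_int j * dx\<bar> \<le> B" "x \<notin> ?S" for f x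
  proof (rule ccontr)
    assume "cell_fun dx f x \<noteq> 0"
    then obtain j where "f j \<noteq> 0" "x \<in> cell dx j" by (rule cell_fun_nonzeroD[OF dx])
    then have "\<bar>of_int j * dx\<bar> \<le> B" "\<bar>x - of_int j * dx\<bar> \<le> dx"
      using that(1) dx by (auto simp: cell_def algebra_simps abs_le_iff)
    then show False using that(2) by auto
  qed
  have S_int: "integrable lebesgue (\<lambda>x. indicator ?S x * c)" for c :: real
    using integrableI_bounded_set_indicator[of ?S lebesgue "\<lambda>_. c" "\<bar>c\<bar>"] compact_lebesgue[of ?S] by simp
  have cf_bound: "\<bar>cell_fun dx f x\<bar> \<le> indicator ?S x * 2"
    if "\<forall>j. f j \<in> {0..1}" "\<forall>j. f j \<noteq> 0 \<longrightarrow> \<bar>of_int j * dx\<bar> \<le> B" for f x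
    using cell_fun_bounds[of dx f x] dx that(1) supp[OF that(2), of x] by (auto simp: indicator_def)
  have pointwise: "(\<lambda>n. cell_fun dx (?u n) x) \<longlonglongrightarrow> cell_fun dx w x" for x
    by (rule cell_fun_tendsto[OF dx lim])

  have "(\<lambda>n. LINT x|lebesgue. \<bar>cell_fun dx (?u n) x - cell_fun dx w x\<bar>) \<longlonglongrightarrow> (LINT x::real|lebesgue. (0::real))"
  proof (rule integral_dominated_convergence[where w="\<lambda>x. indicator ?S x * 4"])
    have "(\<lambda>n. \<bar>cell_fun dx (?u n) x - cell_fun dx w x\<bar>) \<longlonglongrightarrow> \<bar>cell_fun dx w x - cell_fun dx w x\<bar>" for x
      by (intro tendsto_intros pointwise)
    then show "AE x in lebesgue. (\<lambda>n. \<bar>cell_fun dx (?u n) x - cell_fun dx w x\<bar>) \<longlonglongrightarrow> 0" by simp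
    show "AE x in lebesgue. norm \<bar>cell_fun dx (?u n) x - cell_fun dx w x\<bar> \<le> indicator ?S x * 4" for n
    proof (rule AE_I2)
      fix x
      have "\<bar>cell_fun dx (?u n) x\<bar> \<le> indicator ?S x * 2" "\<bar>cell_fun dx w x\<bar> \<le> indicator ?S x * 2"
        by (intro cf_bound allI u01 w01 u_supp w_supp)+
      then show "norm \<bar>cell_fun dx (?u n) x - cell_fun dx w x\<bar> \<le> indicator ?S x * 4"
        by (simp add: abs_le_iff)
    qed
  qed (use S_int in auto)
  moreover have "(LINT x|lebesgue. \<bar>U n x - cell_fun dx w x\<bar>)
      = (LINT x|lebesgue. \<bar>cell_fun dx (?u n) x - cell_fun dx w x\<bar>)" for n
  proof (rule integral_cong_AE)
    have "integrable lebesgue (U n)" using U by (auto simp: admissible_def L1_BV_def)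
    then show "(\<lambda>x. \<bar>U n x - cell_fun dx w x\<bar>) \<in> borel_measurable lebesgue" by measurable
  qed (use eq[of n] in auto)
  ultimately show "(\<lambda>n. LINT x|lebesgue. \<bar>U n x - cell_fun dx w x\<bar>) \<longlonglongrightarrow> 0" by simp

  have int: "integrable lebesgue (cell_fun dx w)"
    by (rule Bochner_Integration.integrable_bound[OF S_int[of 2]])
      (use cf_bound[of w] w01 w_supp in auto)

  \<comment> \<open>The exceptional null set depends on \<open>n\<close>; the countable union gives
    one null set off which the pointwise limit stays in [0,1].\<close>
  have "AE x in lebesgue. \<forall>n. cell_fun dx (?u n) x \<in> {0..1}"
    unfolding AE_all_countable
  proof
    fix n
    have "AE x in lebesgue. U n x \<in> {0..1}" using U by (simp add: admissible_def)
    then show "AE x in lebesgue. cell_fun dx (?u n) x \<in> {0..1}"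
      using eq[of n] by eventually_elim simp
  qed
  then have range: "AE x in lebesgue. cell_fun dx w x \<in> {0..1}"
    by eventually_elim (rule Lim_in_closed_set[OF _ _ _ pointwise]; auto)

  have tv: "total_variation (cell_fun dx w) \<le> ereal M"
    unfolding total_variation_le_iff
  proof (intro allI impI)
    fix \<phi> :: "real \<Rightarrow> real"
    assume \<phi>: "\<phi> C1_differentiable_on UNIV" "compact (closure {x. \<phi> x \<noteq> 0})" "\<forall>x. \<bar>\<phi> x\<bar> \<le> 1"
    then obtain D where "\<And>x. (\<phi> has_vector_derivative D x) (at x)" "continuous_on UNIV D"
      by (auto simp: C1_differentiable_on_def)
    then have cont: "continuous_on UNIV (deriv \<phi>)"
      by (metis DERIV_imp_deriv continuous_on_eq has_real_derivative_iff_has_vector_derivative)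
    then have [measurable]: "deriv \<phi> \<in> borel_measurable lebesgue"
      by (intro borel_measurable_lebesgue borel_measurable_continuous_onI)
    \<comment> \<open>A bound for \<open>deriv \<phi>\<close> on \<open>?S\<close>, which carries
      all cell functions involved, yields the dominating function; the inequality for each fixed
      \<open>\<phi>\<close> then survives the limit.\<close>
    have "bounded (deriv \<phi> ` ?S)"
      by (intro compact_imp_bounded compact_continuous_image continuous_on_subset[OF cont]) auto
    then obtain c where "\<forall>y\<in>deriv \<phi> ` ?S. norm y \<le> c"
      unfolding bounded_iff by blast
    then have c: "\<bar>deriv \<phi> x\<bar> \<le> c" if "x \<in> ?S" for x
      using that by (metis imageI real_norm_def)
    have "(\<lambda>n. LINT x|lebesgue. cell_fun dx (?u n) x * deriv \<phi> x)
        \<longlonglongrightarrow> (LINT x|lebesgue. cell_fun dx w x * deriv \<phi> x)"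
    proof (rule integral_dominated_convergence[where w="\<lambda>x. indicator ?S x * (2 * c)"])
      show "AE x in lebesgue. (\<lambda>n. cell_fun dx (?u n) x * deriv \<phi> x) \<longlonglongrightarrow> cell_fun dx w x * deriv \<phi> x"
        by (intro AE_I2 tendsto_intros pointwise)
      show "AE x in lebesgue. norm (cell_fun dx (?u n) x * deriv \<phi> x) \<le> indicator ?S x * (2 * c)" for n
      proof (rule AE_I2)
        fix x
        have "\<bar>cell_fun dx (?u n) x\<bar> \<le> indicator ?S x * 2"
          by (intro cf_bound allI u01 u_supp)
        then show "norm (cell_fun dx (?u n) x * deriv \<phi> x) \<le> indicator ?S x * (2 * c)"
          using c[of x] by (cases "x \<in> ?S") (auto simp: abs_mult intro!: mult_mono)
      qed
    qed (use S_int in auto)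
    moreover have "(LINT x|lebesgue. cell_fun dx (?u n) x * deriv \<phi> x) \<le> M" for n
    proof -
      have "(LINT x|lebesgue. cell_fun dx (?u n) x * deriv \<phi> x) = (LINT x|lebesgue. U n x * deriv \<phi> x)"
      proof (rule integral_cong_AE)
        have "integrable lebesgue (U n)" using U by (auto simp: admissible_def L1_BV_def)
        then show "(\<lambda>x. U n x * deriv \<phi> x) \<in> borel_measurable lebesgue" by measurable
      qed (use eq[of n] in auto)
      moreover have "total_variation (U n) \<le> ereal M" using U by (simp add: admissible_def)
      ultimately show ?thesis using \<phi> by (simp add: total_variation_le_iff)
    qed
    ultimately show "(LINT x|lebesgue. cell_fun dx w x * deriv \<phi> x) \<le> M"
      by (intro tendsto_upperbound) auto
  qed

  text \<open>\<open>K\<close> need not be closed: the limit is supported in \<open>K\<close> because every cell charged by \<open>w\<close>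
    is already charged by \<open>U n\<close> for large \<open>n\<close>, and only finitely many cells are involved.\<close>
  have "finite {j. w j \<noteq> 0}"
  proof (rule finite_subset)
    show "{j. w j \<noteq> 0} \<subseteq> {- \<lceil>B / dx\<rceil>..\<lceil>B / dx\<rceil>}"
    proof clarify
      fix j assume "w j \<noteq> 0"
      then have "\<bar>of_int j * dx\<bar> \<le> B" using w_supp by blast
      then have "of_int j \<le> B / dx" "- of_int j \<le> B / dx"
        using dx by (auto simp: field_simps abs_le_iff)
      then show "j \<in> {- \<lceil>B / dx\<rceil>..\<lceil>B / dx\<rceil>}" by simp linarith
    qed
  qed simp
  then have "\<forall>\<^sub>F n in sequentially. \<forall>j\<in>{j. w j \<noteq> 0}. ?u n j \<noteq> 0"
    by (intro eventually_ball_finite ballI tendsto_imp_eventually_ne[OF lim]) auto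
  then obtain n where n: "\<And>j. ?u n j = 0 \<Longrightarrow> w j = 0"
    by (auto simp: eventually_sequentially)
  \<comment> \<open>At a face two values are added; being nonnegative, they both vanish when their
    sum does.\<close>
  have zero: "cell_fun dx w x = 0" if "cell_fun dx (?u n) x = 0" for x
    using that n u01[of n] by (auto simp: cell_fun_eq_sum[OF dx] sum_nonneg_eq_0_iff)
  have "AE x in lebesgue. x \<in> A \<longrightarrow> cell_fun dx w x = 0"
    if "AE x in lebesgue. x \<in> A \<longrightarrow> U n x = 0" for A
    using that eq[of n] by eventually_elim (use zero in auto)
  then have "ess_support (cell_fun dx w) \<subseteq> ess_support (U n)"
    by (auto simp: ess_support_def)
  also have "\<dots> \<subseteq> K" using U by (simp add: admissible_def)
  finally have supp_K: "ess_support (cell_fun dx w) \<subseteq> K" .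
  have "total_variation (cell_fun dx w) < \<infinity>" using tv by (rule order.strict_trans1) simp
  then show "cell_fun dx w \<in> admissible dx M K"
    using int range tv supp_K by (auto simp: admissible_def L1_BV_def)
qed

section \<open>Lower semicontinuity along \<open>L1\<close> limits\<close>

lemma lower_semicontinuous_le_lim:
  assumes "lower_semicontinuous_map X f" "limitin X U W sequentially"
    and lim: "(\<lambda>n. f (U n)) \<longlonglongrightarrow> l"
  shows "f W \<le> l"
proof (rule ccontr)
  assume "\<not> f W \<le> l"
  \<comment> \<open>The superlevel set at \<open>a\<close> is an open neighbourhood of
    \<open>W\<close>, so \<open>f (U n)\<close> eventually stays above \<open>a\<close>, which
    exceeds the limit \<open>l\<close>.\<close>
  then obtain a where a: "l < a" "a < f W" using dense[of l "f W"] by (auto simp: not_le)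
  have "W \<in> topspace X" using assms(2) by (rule limitin_topspace)
  then have "\<forall>\<^sub>F n in sequentially. U n \<in> {x \<in> topspace X. a < f x}"
    using assms(1) a(2) by (intro limitinD[OF assms(2)]) (auto simp: lower_semicontinuous_map_def)
  then have "\<forall>\<^sub>F n in sequentially. a \<le> f (U n)" by eventually_elim simp
  then have "a \<le> l" by (intro tendsto_lowerbound[OF lim]) auto
  with a(1) show False by simp
qed

lemma limitin_L1loc_L1:
  assumes U: "\<And>n. integrable lebesgue (U n)" and W: "integrable lebesgue W"
    and lim: "(\<lambda>n. LINT x|lebesgue. \<bar>U n x - W x\<bar>) \<longlonglongrightarrow> 0"
  shows "limitin (L1loc_topology D) U W sequentially"
proof (rule limitin_L1loc_topology)
  fix C :: "'a set" assume C: "compact C"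
  have int: "integrable lebesgue (\<lambda>x. \<bar>U n x - W x\<bar>)" for n
    using U W by (intro integrable_abs Bochner_Integration.integrable_diff)
  show "(\<lambda>n. LINT x:C|lebesgue. \<bar>U n x - W x\<bar>) \<longlonglongrightarrow> 0"
  proof (rule tendsto_sandwich[OF _ _ tendsto_const lim]; intro always_eventually allI)
    fix n
    show "0 \<le> (LINT x:C|lebesgue. \<bar>U n x - W x\<bar>)"
      by (simp add: set_lebesgue_integral_def)
    show "(LINT x:C|lebesgue. \<bar>U n x - W x\<bar>) \<le> (LINT x|lebesgue. \<bar>U n x - W x\<bar>)"
      unfolding set_lebesgue_integral_def
      using compact_lebesgue[OF C] by (intro integral_mono integrable_mult_indicator int) (auto simp: indicator_def)
  qed
qed (use U W in \<open>auto intro: integrable_imp_L1loc\<close>)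

section \<open>Limits of minimizers\<close>

theorem theorem4p5:
  fixes v \<eta> :: "real \<Rightarrow> real"
    and T M dx dt :: real
    and K :: "real set"
    and \<J> \<I> :: "(real \<Rightarrow> real) \<Rightarrow> real"
    and \<K> :: "(real \<times> real \<Rightarrow> real) \<Rightarrow> real"
    and H :: "nat \<Rightarrow> real"
    and Us :: "nat \<Rightarrow> real \<Rightarrow> real"
  assumes v: "\<And>r. r \<in> {0..1} \<Longrightarrow> v r = 1 - r"
    and \<eta>_C2: "C2_on {-1..0} \<eta>"
    and \<eta>_outside: "\<And>x. x \<notin> {-1..0} \<Longrightarrow> \<eta> x = 0"
    and \<eta>_mono: "mono_on {-1..0} \<eta>"
    and \<eta>_norm: "(LINT x|lebesgue. \<bar>\<eta> x\<bar>) = 1"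
    and \<eta>_left: "\<eta> (-1) = 0"
    and pos: "T > 0" "M > 0" "dx > 0" "dt > 0"
    and K: "compact (closure K)"
    and CFL_local: "\<And>Uo. Uo \<in> admissible dx M K \<Longrightarrow> CFL dt dx (local_vel v) Uo"
    and CFL_nonlocal: "\<And>Uo h. Uo \<in> admissible dx M K \<Longrightarrow> h > 0 \<Longrightarrow>
          CFL dt dx (nonlocal_vel dx v \<eta> h) Uo"
    and J_nonneg: "\<And>f. f \<in> L1loc UNIV \<Longrightarrow> 0 \<le> \<J> f"
    and J_cont: "continuous_map (L1loc_topology UNIV) euclideanreal \<J>"
    and K_nonneg: "\<And>f. f \<in> L1loc ({0..T} \<times> UNIV) \<Longrightarrow> 0 \<le> \<K> f"
    and K_cont: "continuous_map (L1loc_topology ({0..T} \<times> UNIV)) euclideanreal \<K>"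
    and I_nonneg: "\<And>f. f \<in> L1loc UNIV \<Longrightarrow> 0 \<le> \<I> f"
    and I_lsc: "lower_semicontinuous_map (L1loc_topology UNIV) \<I>"
    and H_pos: "\<And>n. H n > 0"
    and H_lim: "H \<longlonglongrightarrow> 0"
    and Us_min: "\<And>n. is_arg_min (cost \<J> \<K> \<I> T dt dx (nonlocal_vel dx v \<eta> (H n)))
          (\<lambda>U. U \<in> admissible dx M K) (Us n)"
  shows "\<exists>s Uo. strict_mono s \<and>
    (\<lambda>n. LINT x|lebesgue. \<bar>Us (s n) x - Uo x\<bar>) \<longlonglongrightarrow> 0 \<and>
    is_arg_min (cost \<J> \<K> \<I> T dt dx (local_vel v)) (\<lambda>U. U \<in> admissible dx M K) Uo"
proof -
  have v': "\<forall>r\<in>{0..1}. v r = 1 - r" using v by blast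
  have dt: "8 * dt \<le> dx"
    using pos v by (intro CFL_imp_time_step_bound[of v M dx dt K] CFL_local) auto
  let ?C = "cost \<J> \<K> \<I> T dt dx (local_vel v)"
  let ?u = "\<lambda>n. cell_values dx (Us n)"
  have adm: "Us n \<in> admissible dx M K" for n
    using Us_min[of n] by (simp add: is_arg_min_def)
  note u01 = admissible_cell_values(2)[OF pos(3) adm]
  obtain N where N: "\<And>n. n \<ge> N \<Longrightarrow> H n < dx"
    using order_tendstoD(2)[OF H_lim pos(3)] by (auto simp: eventually_sequentially)
  have "nonlocal_vel dx v \<eta> (H n) = local_vel v" if "n \<ge> N" for n
    using H_pos N[OF that] kernel_pos_at_zero[OF \<eta>_outside \<eta>_mono \<eta>_left \<eta>_norm]
    by (intro nonlocal_vel_eq_local_vel) auto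
  \<comment> \<open>From index \<open>N\<close> on, all \<open>Us n\<close> minimize one and the
    same functional.\<close>
  then have min: "?C (Us n) \<le> ?C U" if "n \<ge> N" "U \<in> admissible dx M K" for n U
    using Us_min[of n] that by (auto simp: is_arg_min_def not_less)
  have "norm (?u n j) \<le> 1" for n j using u01[of n j] by auto
  \<comment> \<open>A diagonal argument over the countably many cells gives one subsequence that
    converges in every cell.\<close>
  then obtain r where r: "strict_mono r" "\<And>j. \<exists>l. (\<lambda>n. ?u (r n) j) \<longlonglongrightarrow> l"
    using function_convergent_subsequence[of UNIV ?u 1] by (metis UNIV_I countableI_type)
  then obtain w where w: "\<And>j. (\<lambda>n. ?u (r n) j) \<longlonglongrightarrow> w j" by metis
  \<comment> \<open>The shift by \<open>N\<close> keeps only indices at which \<open>Us\<close> is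
    known to minimize the local cost.\<close>
  define s where "s n = r (n + N)" for n
  have s: "strict_mono s" using r(1) by (simp add: s_def strict_mono_def)
  have sN: "s n \<ge> N" for n
    using seq_suble[OF r(1), of "n + N"] by (simp add: s_def)
  have lim: "(\<lambda>n. ?u (s n) j) \<longlonglongrightarrow> w j" for j
    unfolding s_def by (rule LIMSEQ_ignore_initial_segment[OF w])
  let ?W = "cell_fun dx w"
  have "bounded K" using K by (meson bounded_subset closure_subset compact_imp_bounded)
  note limit = admissible_limit[OF pos(3) this adm lim]
  have vals: "cell_values dx ?W = w" by (rule cell_values_eq[OF pos(3)]) simp
  have w01: "w j \<in> {0..1}" for j
    using admissible_cell_values(2)[OF pos(3) limit(1)] by (simp add: vals)
  note sol = limitin_EL_solution[OF v' pos(4) dt, of "\<lambda>n. Us (s n)" ?W, unfolded vals, OF u01 w01 lim]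
  have J: "(\<lambda>n. \<J> (EL_solution dt dx (local_vel v) (Us (s n)) T))
      \<longlonglongrightarrow> \<J> (EL_solution dt dx (local_vel v) ?W T)"
    using continuous_map_limit[OF J_cont sol(1)] by (simp add: o_def)
  have Kl: "(\<lambda>n. \<K> (\<lambda>(t, x). EL_solution dt dx (local_vel v) (Us (s n)) t x))
      \<longlonglongrightarrow> \<K> (\<lambda>(t, x). EL_solution dt dx (local_vel v) ?W t x)"
    using continuous_map_limit[OF K_cont sol(2)] by (simp add: o_def)
  have integrable: "integrable lebesgue U" if "U \<in> admissible dx M K" for U
    using that by (simp add: admissible_def L1_BV_def)
  have L1: "limitin (L1loc_topology UNIV) (\<lambda>n. Us (s n)) ?W sequentially"
    by (intro limitin_L1loc_L1 integrable adm limit)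
  \<comment> \<open>All \<open>Us (s n)\<close> share the minimal local cost, so
    \<open>\<I> (Us (s n))\<close> is this constant minus two convergent terms and hence converges
    itself. Lower semicontinuity can then be compared with an actual limit.\<close>
  let ?I = "\<lambda>n. ?C (Us (s 0)) - \<J> (EL_solution dt dx (local_vel v) (Us (s n)) T)
      - \<K> (\<lambda>(t, x). EL_solution dt dx (local_vel v) (Us (s n)) t x)"
  have "?C (Us (s n)) = ?C (Us (s 0))" for n
    by (intro antisym min sN adm)
  then have "\<I> (Us (s n)) = ?I n" for n
    by (simp add: cost_def algebra_simps)
  then have "(\<lambda>n. \<I> (Us (s n))) \<longlonglongrightarrow> ?C (Us (s 0)) - \<J> (EL_solution dt dx (local_vel v) ?W T)
      - \<K> (\<lambda>(t, x). EL_solution dt dx (local_vel v) ?W t x)"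
    by (simp only:) (intro tendsto_intros J Kl)
  then have "?C ?W \<le> ?C (Us (s 0))"
    using lower_semicontinuous_le_lim[OF I_lsc L1] by (fastforce simp: cost_def)
  then have "is_arg_min ?C (\<lambda>U. U \<in> admissible dx M K) ?W"
    using limit(1) min[OF sN[of 0]] by (auto simp: is_arg_min_def not_less intro: order_trans)
  with s limit(2) show ?thesis by blast
qed

end
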